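(* The set of all complex numbers $z$ such that $\mathrm{C}(G;z)=0$ for some finite simple graph $G$ is dense in $\mathbb{C}$. Moreover, this remains true if $G$ is restricted to range over connected finite simple graphs.
   Context: For a finite simple undirected graph $G$ with $n$ nodes, a connected set of $G$ is a nonempty subset of nodes inducing a connected subgraph, and $c_k$ denotes the number of connected sets of $G$ of order $k$. The connected set polynomial of $G$ is $\mathrm{C}(G;x)=\sum_{k=1}^n c_k x^k$; its roots are the connected set roots of $G$. *)

theory Defs
  imports
    "HOL-Analysis.Analysis"
    "HOL-Computational_Algebra.Polynomial"
    "Graph_Theory.Graph_Theory"
begin

text \<open>
  A finite simple undirected graph is a \<^const>\<open>pair_graph\<close>: a finite, loop-free, symmetric set of
  arcs on a finite vertex set, each undirected edge being represented by its two orientations.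
  Vertices are taken from \<^typ>\<open>nat\<close> in the final result, which covers all finite graphs up to
  isomorphism.  The constant \<^const>\<open>Digraph_Component.connected\<close> is graph connectedness, not the
  topological notion of the same base name.
\<close>

definition connected_sets :: "'a pair_pre_digraph \<Rightarrow> 'a set set" where
  "connected_sets G =
     {S. S \<noteq> {} \<and> S \<subseteq> pverts G \<and> Digraph_Component.connected (with_proj G \<restriction> S)}"

definition num_connected_sets :: "'a pair_pre_digraph \<Rightarrow> nat \<Rightarrow> nat" where
  "num_connected_sets G k = card {S \<in> connected_sets G. card S = k}"

definition connected_set_poly :: "'a pair_pre_digraph \<Rightarrow> complex poly" where
  "connected_set_poly G =
     (\<Sum>k = 1..card (pverts G). monom (of_nat (num_connected_sets G k)) k)"

text \<open>
  The null graph is excluded: its polynomial is the zero polynomial, for which every complex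
  number would be a root.
\<close>

definition simple_graph :: "'a pair_pre_digraph \<Rightarrow> bool" where
  "simple_graph G \<longleftrightarrow> pair_graph G \<and> pverts G \<noteq> {}"

end

theory Submission
  imports Defs "HOL-Number_Theory.Cong"
begin

text \<open>
  Replacing every vertex of a graph by a clique of order \<open>m\<close> substitutes \<open>(1 + x)\<^sup>m - 1\<close> for \<open>x\<close> in
  the connected set polynomial. Hence the set \<open>U\<close> of all \<open>1 + z\<close>, where \<open>z\<close> is a root for a connected
  graph, contains every \<open>m\<close>-th root of each of its elements. For odd \<open>n \<ge> 5\<close> the intermediate value
  theorem yields two roots \<open>- 1 - t\<close> of \<open>C(C\<^sub>n; x)\<close>, one with \<open>t\<close> in \<open>[n - 3, n - 2]\<close> and one with \<open>t\<close>
  of order \<open>1 / n\<^sup>2\<close>. So \<open>U\<close> has, for every \<open>r > 0\<close>, elements whose modulus agrees with \<open>r\<^sup>m\<close> up to a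
  factor that does not depend on \<open>m\<close>. As \<open>m\<close> grows, the modulus of their \<open>m\<close>-th roots tends to \<open>r\<close>,
  while the arguments of these roots become dense.
\<close>

section \<open>Connected sets\<close>

lemma (in pair_graph) mem_connected_sets_iff:
  "S \<in> connected_sets G \<longleftrightarrow> S \<noteq> {} \<and> S \<subseteq> pverts G \<and>
    (\<forall>u\<in>S. \<forall>v\<in>S. (u, v) \<in> rtrancl_on S (parcs G \<inter> S \<times> S))"
proof -
  have "parcs (mk_symmetric (with_proj G \<restriction> S)) = parcs G \<inter> S \<times> S"
    using arcs_symmetric by (fastforce simp: parcs_mk_symmetric)
  then show ?thesis
    by (auto simp: connected_sets_def Digraph_Component.connected_def strongly_connected_def
        reachable_def)
qed

lemma (in pair_graph) closed_subset_eq_connected_set: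
  assumes "S \<in> connected_sets G" "A \<subseteq> S" "A \<noteq> {}" "parcs G `` A \<inter> S \<subseteq> A"
  shows "A = S"
proof -
  obtain u where u: "u \<in> A" using assms(3) by blast
  have "v \<in> A" if "v \<in> S" for v
  proof -
    have "(u, v) \<in> rtrancl_on S (parcs G \<inter> S \<times> S)"
      using assms(1,2) u that by (auto simp: mem_connected_sets_iff)
    then show "v \<in> A"
      by (induct rule: rtrancl_on_induct) (use u assms(4) in auto)
  qed
  then show ?thesis using assms(2) by blast
qed

lemma (in pair_graph) connected_setsI:
  assumes "S \<noteq> {}" "S \<subseteq> pverts G"
    and closed: "\<And>A. A \<subseteq> S \<Longrightarrow> A \<noteq> {} \<Longrightarrow> parcs G `` A \<inter> S \<subseteq> A \<Longrightarrow> A = S"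
  shows "S \<in> connected_sets G"
proof -
  have "{v. (u, v) \<in> rtrancl_on S (parcs G \<inter> S \<times> S)} = S" (is "?A = S") if "u \<in> S" for u
  proof (rule closed)
    show "?A \<subseteq> S" using in_rtrancl_on_in_F by fast
    then show "parcs G `` ?A \<inter> S \<subseteq> ?A" by (auto intro: rtrancl_on_into_rtrancl_on)
    have "u \<in> ?A" using that by simp
    then show "?A \<noteq> {}" by blast
  qed
  then show ?thesis using assms(1,2) by (auto simp: mem_connected_sets_iff)
qed

lemma (in pair_graph) pverts_mem_connected_sets_iff:
  "pverts G \<in> connected_sets G \<longleftrightarrow> pverts G \<noteq> {} \<and> Digraph_Component.connected (with_proj G)"
proof -
  have "with_proj G \<restriction> pverts G = with_proj G"
    using in_arcsD1 in_arcsD2 by (auto simp: induce_subgraph_def with_proj_def)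
  then show ?thesis by (simp add: connected_sets_def)
qed

lemma finite_connected_sets: "finite (pverts G) \<Longrightarrow> finite (connected_sets G)"
  by (rule finite_subset[of _ "Pow (pverts G)"]) (auto simp: connected_sets_def)

lemma poly_connected_set_poly:
  assumes "finite (pverts G)"
  shows "poly (connected_set_poly G) z = (\<Sum>S\<in>connected_sets G. z ^ card S)"
proof -
  have card: "card ` connected_sets G \<subseteq> {1..card (pverts G)}"
  proof (intro image_subsetI)
    fix S assume "S \<in> connected_sets G"
    then have "S \<noteq> {}" "S \<subseteq> pverts G" by (simp_all add: connected_sets_def)
    with assms show "card S \<in> {1..card (pverts G)}"
      by (auto simp: Suc_le_eq card_gt_0_iff card_mono dest: finite_subset)
  qed
  have "poly (connected_set_poly G) z =
      (\<Sum>k = 1..card (pverts G). \<Sum>S | S \<in> connected_sets G \<and> card S = k. z ^ card S)"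
    by (simp add: connected_set_poly_def num_connected_sets_def poly_sum poly_monom)
  also have "\<dots> = (\<Sum>S\<in>connected_sets G. z ^ card S)"
    by (rule sum.group[OF finite_connected_sets[OF assms] _ card]) simp
  finally show ?thesis .
qed

section \<open>Replacing vertices by cliques\<close>

definition clique_blowup :: "('b \<Rightarrow> 'a) \<Rightarrow> 'b set \<Rightarrow> 'a pair_pre_digraph \<Rightarrow> 'b pair_pre_digraph" where
  "clique_blowup f V G = \<lparr>pverts = V,
     parcs = {(u, v) \<in> V \<times> V. u \<noteq> v \<and> (f u = f v \<or> (f u, f v) \<in> parcs G)}\<rparr>"

lemma pverts_clique_blowup [simp]: "pverts (clique_blowup f V G) = V"
  by (simp add: clique_blowup_def)

lemma pair_graph_clique_blowup:
  assumes "pair_graph G" "finite V"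
  shows "pair_graph (clique_blowup f V G)"
proof -
  interpret pair_graph G by fact
  show ?thesis
  proof
    show "finite (parcs (clique_blowup f V G))"
      by (rule finite_subset[of _ "V \<times> V"]) (use assms in \<open>auto simp: clique_blowup_def\<close>)
    show "symmetric (with_proj (clique_blowup f V G))"
      using arcs_symmetric by (auto simp: symmetric_def sym_def clique_blowup_def)
  qed (use assms in \<open>auto simp: clique_blowup_def\<close>)
qed

lemma image_connected_set_clique_blowup:
  assumes "pair_graph G" "finite V" "f ` V \<subseteq> pverts G" "S \<in> connected_sets (clique_blowup f V G)"
  shows "f ` S \<in> connected_sets G"
proof -
  interpret G: pair_graph G by fact
  interpret B: pair_graph "clique_blowup f V G"
    using assms(1,2) by (rule pair_graph_clique_blowup)
  have S: "S \<noteq> {}" "S \<subseteq> V" using assms(4) by (simp_all add: connected_sets_def)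
  show ?thesis
  proof (rule G.connected_setsI)
    show "f ` S \<noteq> {}" "f ` S \<subseteq> pverts G" using S assms(3) by auto
    fix A assume A: "A \<subseteq> f ` S" "A \<noteq> {}" "parcs G `` A \<inter> f ` S \<subseteq> A"
    then have "{v \<in> S. f v \<in> A} = S"
      by (intro B.closed_subset_eq_connected_set[OF assms(4)]) (auto simp: clique_blowup_def)
    then show "A = f ` S" using A(1) by blast
  qed
qed

lemma connected_set_clique_blowupI:
  assumes "pair_graph G" "finite V" "S \<subseteq> V" "f ` S \<in> connected_sets G"
  shows "S \<in> connected_sets (clique_blowup f V G)"
proof -
  interpret G: pair_graph G by fact
  interpret B: pair_graph "clique_blowup f V G"
    using assms(1,2) by (rule pair_graph_clique_blowup)
  show ?thesis
  proof (rule B.connected_setsI)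
    show "S \<noteq> {}" "S \<subseteq> pverts (clique_blowup f V G)"
      using assms(3,4) by (auto simp: connected_sets_def)
    fix A assume A: "A \<subseteq> S" "A \<noteq> {}" "parcs (clique_blowup f V G) `` A \<inter> S \<subseteq> A"
    have closed: "v \<in> A" if "u \<in> A" "v \<in> S" "f u = f v \<or> (f u, f v) \<in> parcs G" for u v
    proof (cases "u = v")
      case False
      then have "(u, v) \<in> parcs (clique_blowup f V G)"
        using that A(1) assms(3) by (auto simp: clique_blowup_def)
      then show ?thesis using that A(3) by blast
    qed (use that in simp)
    have "f ` A = f ` S"
      using A(1,2) closed by (intro G.closed_subset_eq_connected_set[OF assms(4)]) blast+
    then have "\<exists>u\<in>A. f u = f v" if "v \<in> S" for v using that by (metis imageE imageI)
    then show "A = S" using closed A(1) by blast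
  qed
qed

lemma connected_sets_clique_blowup:
  assumes "pair_graph G" "finite V" "f ` V \<subseteq> pverts G"
  shows "connected_sets (clique_blowup f V G) = {S. S \<subseteq> V \<and> f ` S \<in> connected_sets G}"
proof -
  have "S \<subseteq> V" if "S \<in> connected_sets (clique_blowup f V G)" for S
    using that by (simp add: connected_sets_def)
  then show ?thesis
    using image_connected_set_clique_blowup[OF assms] connected_set_clique_blowupI[OF assms(1,2)]
    by blast
qed

lemma sum_pow_card_Pow:
  fixes z :: "'a :: comm_ring_1"
  assumes "finite A"
  shows "(\<Sum>B\<in>Pow A. z ^ card B) = (1 + z) ^ card A"
  using prod_add[OF assms, of "\<lambda>_. z" "\<lambda>_. 1"] by (simp add: add.commute[of z])

lemma bij_betw_UN_PiE_fibres:
  "bij_betw (\<lambda>g. \<Union>t\<in>T. g t) (\<Pi>\<^sub>E t\<in>T. Pow {v \<in> V. f v = t} - {{}}) {S. S \<subseteq> V \<and> f ` S = T}"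
    (is "bij_betw ?U ?P ?I")
proof (rule bij_betwI[where g = "\<lambda>S. \<lambda>t\<in>T. {v \<in> S. f v = t}"])
  have mem: "v \<in> V" "f v = t" if "g \<in> ?P" "t \<in> T" "v \<in> g t" for g t v
    using PiE_mem[OF that(1,2)] that(3) by auto
  show "?U \<in> ?P \<rightarrow> ?I"
  proof
    fix g assume g: "g \<in> ?P"
    have "t \<in> f ` ?U g" if t: "t \<in> T" for t
    proof -
      obtain v where "v \<in> g t" using PiE_mem[OF g t] by blast
      then show ?thesis using mem(2)[OF g t] t by blast
    qed
    then show "?U g \<in> ?I" using mem[OF g] by auto
  qed
  show "(\<lambda>S. \<lambda>t\<in>T. {v \<in> S. f v = t}) \<in> ?I \<rightarrow> ?P" by auto
  show "(\<lambda>t\<in>T. {v \<in> ?U g. f v = t}) = g" if g: "g \<in> ?P" for g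
  proof (rule extensionalityI)
    show "g \<in> extensional T" using g by (simp add: PiE_iff)
    show "(\<lambda>t\<in>T. {v \<in> ?U g. f v = t}) t = g t" if t: "t \<in> T" for t
    proof -
      have "{v \<in> ?U g. f v = t} = g t" using mem[OF g] t by blast
      then show ?thesis using t by simp
    qed
  qed simp
  show "?U (\<lambda>t\<in>T. {v \<in> S. f v = t}) = S" if "S \<in> ?I" for S using that by auto
qed

lemma sum_pow_card_image_eq:
  fixes z :: "'a :: comm_ring_1"
  assumes "finite V" "finite T"
  shows "(\<Sum>S | S \<subseteq> V \<and> f ` S = T. z ^ card S) =
    (\<Prod>t\<in>T. (1 + z) ^ card {v \<in> V. f v = t} - 1)"
proof -
  let ?F = "\<lambda>t. {v \<in> V. f v = t}"
  let ?P = "\<Pi>\<^sub>E t\<in>T. Pow (?F t) - {{}}"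
  have card_UN: "card (\<Union>t\<in>T. g t) = (\<Sum>t\<in>T. card (g t))" if "g \<in> ?P" for g
  proof (rule card_UN_disjoint[OF assms(2)])
    have g: "g t \<subseteq> ?F t" if "t \<in> T" for t using PiE_mem[OF \<open>g \<in> ?P\<close> that] by simp
    then show "\<forall>t\<in>T. finite (g t)" using assms(1) by (simp add: finite_subset[OF g])
    show "\<forall>t\<in>T. \<forall>t'\<in>T. t \<noteq> t' \<longrightarrow> g t \<inter> g t' = {}" using g by blast
  qed
  have "(\<Sum>S | S \<subseteq> V \<and> f ` S = T. z ^ card S) = (\<Sum>g\<in>?P. z ^ card (\<Union>t\<in>T. g t))"
    by (rule sum.reindex_bij_betw[OF bij_betw_UN_PiE_fibres, symmetric])
  also have "\<dots> = (\<Sum>g\<in>?P. \<Prod>t\<in>T. z ^ card (g t))"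
    by (intro sum.cong refl) (simp add: card_UN power_sum)
  also have "\<dots> = (\<Prod>t\<in>T. \<Sum>B\<in>Pow (?F t) - {{}}. z ^ card B)"
    using assms by (intro prod_sum_PiE[symmetric]) auto
  also have "\<dots> = (\<Prod>t\<in>T. (1 + z) ^ card (?F t) - 1)"
    using assms(1) by (simp add: sum_diff1 sum_pow_card_Pow)
  finally show ?thesis .
qed

lemma poly_connected_set_poly_clique_blowup:
  assumes "pair_graph G" "finite V" "f ` V \<subseteq> pverts G"
  shows "poly (connected_set_poly (clique_blowup f V G)) z =
    (\<Sum>T\<in>connected_sets G. \<Prod>t\<in>T. (1 + z) ^ card {v \<in> V. f v = t} - 1)"
proof -
  interpret pair_graph G by fact
  let ?C = "{S. S \<subseteq> V \<and> f ` S \<in> connected_sets G}"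
  have "poly (connected_set_poly (clique_blowup f V G)) z = (\<Sum>S\<in>?C. z ^ card S)"
    using assms by (simp add: poly_connected_set_poly connected_sets_clique_blowup)
  also have "\<dots> = (\<Sum>T\<in>connected_sets G. \<Sum>S | S \<in> ?C \<and> f ` S = T. z ^ card S)"
    using assms(2) by (intro sum.group[symmetric] finite_connected_sets) auto
  also have "\<dots> = (\<Sum>T\<in>connected_sets G. \<Sum>S | S \<subseteq> V \<and> f ` S = T. z ^ card S)"
    by (intro sum.cong) auto
  also have "\<dots> = (\<Sum>T\<in>connected_sets G. \<Prod>t\<in>T. (1 + z) ^ card {v \<in> V. f v = t} - 1)"
    using assms(2) by (intro sum.cong refl sum_pow_card_image_eq)
      (auto simp: connected_sets_def intro: finite_subset)
  finally show ?thesis .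
qed

lemma poly_connected_set_poly_uniform_clique_blowup:
  assumes "pair_graph G" "finite V" "f ` V \<subseteq> pverts G"
    and "\<And>t. t \<in> pverts G \<Longrightarrow> card {v \<in> V. f v = t} = m"
  shows "poly (connected_set_poly (clique_blowup f V G)) z =
    poly (connected_set_poly G) ((1 + z) ^ m - 1)"
proof -
  interpret pair_graph G by fact
  have "(\<Prod>t\<in>T. (1 + z) ^ card {v \<in> V. f v = t} - 1) = ((1 + z) ^ m - 1) ^ card T"
    if "T \<in> connected_sets G" for T
    using that assms(4) by (auto simp: connected_sets_def subset_iff)
  then show ?thesis
    by (simp add: poly_connected_set_poly_clique_blowup[OF assms(1-3)] poly_connected_set_poly)
qed

definition connected_graph_roots :: "complex set" where
  "connected_graph_roots = {z. \<exists>G :: nat pair_pre_digraph. simple_graph G \<and>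
     Digraph_Component.connected (with_proj G) \<and> poly (connected_set_poly G) z = 0}"

lemma mem_connected_graph_roots_if_power:
  assumes "m > 0" "(1 + z) ^ m - 1 \<in> connected_graph_roots"
  shows "z \<in> connected_graph_roots"
proof -
  obtain G :: "nat pair_pre_digraph" where G: "pair_graph G" "pverts G \<in> connected_sets G"
      "pverts G \<noteq> {}" "poly (connected_set_poly G) ((1 + z) ^ m - 1) = 0"
    using assms(2) pair_graph.pverts_mem_connected_sets_iff
    by (auto simp: connected_graph_roots_def simple_graph_def)
  interpret G: pair_graph G by fact
  define f :: "nat \<Rightarrow> nat" where "f = fst \<circ> prod_decode"
  define V where "V = prod_encode ` (pverts G \<times> {..<m})"
  have V: "finite V" "f ` V = pverts G"
    using assms(1) by (auto simp: V_def f_def image_image)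
  interpret B: pair_graph "clique_blowup f V G"
    using G(1) V(1) by (rule pair_graph_clique_blowup)
  have "card {v \<in> V. f v = t} = m" if "t \<in> pverts G" for t
  proof -
    have "{v \<in> V. f v = t} = prod_encode ` ({t} \<times> {..<m})"
      using that by (auto simp: V_def f_def)
    then show ?thesis by (simp add: card_image inj_prod_encode)
  qed
  then have "poly (connected_set_poly (clique_blowup f V G)) z = 0"
    using poly_connected_set_poly_uniform_clique_blowup[OF G(1) V(1)] V(2) G(4) by simp
  moreover have "V \<in> connected_sets (clique_blowup f V G)"
    using connected_sets_clique_blowup[OF G(1) V(1)] V(2) G(2) by simp
  ultimately show ?thesis
    using B.pverts_mem_connected_sets_iff B.pair_graph
    by (auto simp: connected_graph_roots_def simple_graph_def)
qed

section \<open>Connected sets of cycles\<close>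

definition cycle_graph :: "nat \<Rightarrow> nat pair_pre_digraph" where
  "cycle_graph n = \<lparr>pverts = {..<n},
     parcs = {(u, v) \<in> {..<n} \<times> {..<n}. u \<noteq> v \<and> (v = Suc u mod n \<or> u = Suc v mod n)}\<rparr>"

definition cyclic_interval :: "nat \<Rightarrow> nat \<Rightarrow> nat \<Rightarrow> nat set" where
  "cyclic_interval n i k = (\<lambda>j. (i + j) mod n) ` {..<k}"

lemma pverts_cycle_graph [simp]: "pverts (cycle_graph n) = {..<n}"
  by (simp add: cycle_graph_def)

lemma pair_graph_cycle_graph: "pair_graph (cycle_graph n)"
proof
  show "finite (parcs (cycle_graph n))"
    by (rule finite_subset[of _ "{..<n} \<times> {..<n}"]) (auto simp: cycle_graph_def)
  show "symmetric (with_proj (cycle_graph n))"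
    by (auto simp: symmetric_def sym_def cycle_graph_def)
qed (auto simp: cycle_graph_def)

lemma inj_on_add_mod: "inj_on (\<lambda>j. (i + j) mod n) {..<n :: nat}"
proof (rule inj_onI)
  fix j j' assume j: "j \<in> {..<n}" "j' \<in> {..<n}" and "(i + j) mod n = (i + j') mod n"
  then have "[i + j = i + j'] (mod n)" by (simp only: cong_def)
  then show "j = j'" using j cong_less_modulus_unique_nat by (simp add: cong_add_lcancel_nat)
qed

lemma ex_add_mod_eq:
  fixes x y n :: nat
  assumes "x < n" "y < n"
  obtains j where "j < n" "(x + j) mod n = y"
proof
  show "(n - x + y) mod n < n" using assms by simp
  show "(x + (n - x + y) mod n) mod n = y"
    using assms by (simp add: mod_add_right_eq)
qed

lemma card_cyclic_interval:
  assumes "k \<le> n"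
  shows "card (cyclic_interval n i k) = k"
  using inj_on_subset[OF inj_on_add_mod, of "{..<k}" n] assms
  by (simp add: cyclic_interval_def card_image)

lemma add_mod_mem_cyclic_interval_iff:
  assumes "k \<le> n" "j < n"
  shows "(i + j) mod n \<in> cyclic_interval n i k \<longleftrightarrow> j < k"
  using inj_on_image_mem_iff[OF inj_on_add_mod, of j n "{..<k}" i] assms
  by (auto simp: cyclic_interval_def)

lemma cyclic_interval_full: "cyclic_interval n 0 n = {..<n}"
  by (auto simp: cyclic_interval_def)

lemma cyclic_interval_start_inject:
  assumes "0 < k" "k < n" "i < n" "i' < n" "cyclic_interval n i k = cyclic_interval n i' k"
  shows "i = i'"
proof -
  obtain j where j: "j < n" "(i' + j) mod n = i" using ex_add_mod_eq assms by blast
  have "j = 0"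
  proof (rule ccontr)
    assume "j \<noteq> 0"
    have "(i + 0) mod n \<in> cyclic_interval n i k"
      using assms by (subst add_mod_mem_cyclic_interval_iff) auto
    then have "(i' + j) mod n \<in> cyclic_interval n i' k"
      using assms j by simp
    then have "j < k" using assms(2) j(1) by (simp add: add_mod_mem_cyclic_interval_iff)
    then have "(i' + (j - 1)) mod n \<in> cyclic_interval n i' k"
      using assms(2) by (subst add_mod_mem_cyclic_interval_iff) auto
    moreover have "(i' + (j - 1)) mod n = (i + (n - 1)) mod n"
    proof -
      have "(i + (n - 1)) mod n = (i' + j + (n - 1)) mod n"
        unfolding j(2)[symmetric] by (rule mod_add_left_eq)
      also have "i' + j + (n - 1) = i' + (j - 1) + n" using \<open>j \<noteq> 0\<close> assms(2) by simp
      finally show ?thesis by simp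
    qed
    ultimately have "(i + (n - 1)) mod n \<in> cyclic_interval n i k" using assms(5) by simp
    then have "n - 1 < k"
      using add_mod_mem_cyclic_interval_iff[of k n "n - 1" i] assms(2) by simp
    then show False using assms(2) by simp
  qed
  then show ?thesis using j(2) assms(4) by simp
qed

lemma cyclic_interval_mem_connected_sets:
  assumes "n > 0" "k > 0"
  shows "cyclic_interval n i k \<in> connected_sets (cycle_graph n)" (is "?I \<in> _")
proof -
  interpret pair_graph "cycle_graph n" by (rule pair_graph_cycle_graph)
  show ?thesis
  proof (rule connected_setsI)
    show "?I \<noteq> {}" "?I \<subseteq> pverts (cycle_graph n)"
      using assms by (auto simp: cyclic_interval_def)
    show "A = ?I" if A: "A \<subseteq> ?I" "A \<noteq> {}" "parcs (cycle_graph n) `` A \<inter> ?I \<subseteq> A" for A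
    proof -
      have mem: "(i + j) mod n \<in> ?I" if "j < k" for j
        using that by (auto simp: cyclic_interval_def)
      have step: "(i + j) mod n \<in> A \<longleftrightarrow> (i + Suc j) mod n \<in> A" if "Suc j < k" for j
      proof (cases "(i + j) mod n = (i + Suc j) mod n")
        case False
        then have "((i + j) mod n, (i + Suc j) mod n) \<in> parcs (cycle_graph n)"
          "((i + Suc j) mod n, (i + j) mod n) \<in> parcs (cycle_graph n)"
          using assms(1) by (auto simp: cycle_graph_def mod_Suc_eq)
        then show ?thesis using A(3) mem[of j] mem[of "Suc j"] that by auto
      qed simp
      have start: "(i + j) mod n \<in> A \<longleftrightarrow> i mod n \<in> A" if "j < k" for j
        using that by (induction j) (use step in auto)
      obtain j where "j < k" "(i + j) mod n \<in> A"
        using A(1,2) by (auto simp: cyclic_interval_def)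
      then have "i mod n \<in> A" using start by blast
      then show "A = ?I" using A(1) start by (auto simp: cyclic_interval_def)
    qed
  qed
qed

lemma lessThan_mem_connected_sets_cycle_graph:
  assumes "n > 0"
  shows "{..<n} \<in> connected_sets (cycle_graph n)"
  using cyclic_interval_mem_connected_sets[OF assms assms, of 0] by (simp add: cyclic_interval_full)

lemma ex_maximal_cyclic_interval:
  assumes "S \<subset> {..<n}" "S \<noteq> {}"
  obtains i k where "i < n" "k \<in> {1..<n}" "cyclic_interval n i k \<subseteq> S"
    "(i + (n - 1)) mod n \<notin> S" "(i + k) mod n \<notin> S"
proof -
  obtain q x where q: "q < n" "q \<notin> S" and x: "x < n" "x \<in> S" using assms by blast
  obtain d where "(q + d) mod n \<in> S" using ex_add_mod_eq[OF q(1) x(1)] x(2) by metis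
  then obtain e where e: "(q + e) mod n \<notin> S" "(q + Suc e) mod n \<in> S"
    using ex_least_nat_less[of "\<lambda>d. (q + d) mod n \<in> S" d] q by auto
  define i where "i = (q + Suc e) mod n"
  have i: "i < n" "i \<in> S" using e(2) q(1) by (simp_all add: i_def)
  have "(i + (n - 1)) mod n = (q + Suc e + (n - 1)) mod n"
    unfolding i_def by (rule mod_add_left_eq)
  also have "q + Suc e + (n - 1) = q + e + n" using q(1) by simp
  finally have before: "(i + (n - 1)) mod n \<notin> S" using e(1) by simp
  then obtain l where l: "l < n - 1" "\<And>j. j \<le> l \<Longrightarrow> (i + j) mod n \<in> S" "(i + Suc l) mod n \<notin> S"
    using ex_least_nat_less[of "\<lambda>j. (i + j) mod n \<notin> S" "n - 1"] i by auto
  have "cyclic_interval n i (Suc l) \<subseteq> S"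
    using l(2) by (auto simp: cyclic_interval_def less_Suc_eq_le)
  then show thesis using that[of i "Suc l"] i(1) l(1,3) before by simp
qed

lemma Image_cyclic_interval_subset:
  "parcs (cycle_graph n) `` cyclic_interval n i k \<subseteq>
    {(i + (n - 1)) mod n, (i + k) mod n} \<union> cyclic_interval n i k" (is "_ \<subseteq> ?N \<union> ?I")
proof
  fix v assume "v \<in> parcs (cycle_graph n) `` ?I"
  then obtain j where j: "j < k" "((i + j) mod n, v) \<in> parcs (cycle_graph n)"
    by (auto simp: cyclic_interval_def)
  then have v: "v < n" "v = (i + Suc j) mod n \<or> (i + j) mod n = (1 + v) mod n"
    by (auto simp: cycle_graph_def mod_Suc_eq)
  from v(2) show "v \<in> ?N \<union> ?I"
  proof
    assume succ: "v = (i + Suc j) mod n"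
    show ?thesis
    proof (cases "Suc j = k")
      case False
      with j(1) have "Suc j < k" by simp
      then show ?thesis unfolding succ cyclic_interval_def by blast
    qed (use succ in simp)
  next
    assume pred: "(i + j) mod n = (1 + v) mod n"
    have "(i + j + (n - 1)) mod n = (1 + v + (n - 1)) mod n"
      using pred by (rule mod_add_cong) simp
    then have v_eq: "v = (i + j + (n - 1)) mod n" using v(1) by simp
    show ?thesis
    proof (cases j)
      case 0
      then show ?thesis using v_eq by simp
    next
      case (Suc h)
      then have "i + j + (n - 1) = i + h + n" using v(1) by simp
      then have "v = (i + h) mod n" by (simp only: v_eq mod_add_self2)
      then show ?thesis using j(1) Suc by (auto simp: cyclic_interval_def)
    qed
  qed
qed

lemma connected_set_cycle_graph_eq_cyclic_interval:
  assumes "S \<in> connected_sets (cycle_graph n)" "S \<noteq> {..<n}"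
  obtains i k where "i < n" "k \<in> {1..<n}" "S = cyclic_interval n i k"
proof -
  interpret pair_graph "cycle_graph n" by (rule pair_graph_cycle_graph)
  have "S \<subset> {..<n}" "S \<noteq> {}" using assms by (auto simp: connected_sets_def)
  then obtain i k where ik: "i < n" "k \<in> {1..<n}" and interval: "cyclic_interval n i k \<subseteq> S"
    and ends: "(i + (n - 1)) mod n \<notin> S" "(i + k) mod n \<notin> S"
    by (rule ex_maximal_cyclic_interval)
  have "parcs (cycle_graph n) `` cyclic_interval n i k \<inter> S \<subseteq> cyclic_interval n i k"
    using Image_cyclic_interval_subset[of n i k] ends by blast
  moreover have "cyclic_interval n i k \<noteq> {}"
    using ik(2) by (auto simp: cyclic_interval_def lessThan_empty_iff)
  ultimately have "cyclic_interval n i k = S"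
    by (intro closed_subset_eq_connected_set[OF assms(1) interval])
  then show thesis using that ik by blast
qed

lemma bij_betw_cyclic_interval:
  "bij_betw (\<lambda>(i, k). cyclic_interval n i k) ({..<n} \<times> {1..<n})
     (connected_sets (cycle_graph n) - {{..<n}})" (is "bij_betw ?I ?P ?C")
proof (intro bij_betw_imageI subset_antisym)
  show "inj_on ?I ?P"
  proof (rule inj_onI, clarify)
    fix i k i' k'
    assume ik: "i < n" "k \<in> {1..<n}" "i' < n" "k' \<in> {1..<n}"
      and eq: "cyclic_interval n i k = cyclic_interval n i' k'"
    have "k = card (cyclic_interval n i k)" using ik(2) by (simp add: card_cyclic_interval)
    also have "\<dots> = k'" unfolding eq using ik(4) by (simp add: card_cyclic_interval)
    finally have "k = k'" .
    moreover from this have "i = i'"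
      using ik eq by (intro cyclic_interval_start_inject[of k n i i']) auto
    ultimately show "i = i' \<and> k = k'" by blast
  qed
  have "cyclic_interval n i k \<in> ?C" if "i < n" "k \<in> {1..<n}" for i k
  proof -
    have "card (cyclic_interval n i k) \<noteq> n" using that by (simp add: card_cyclic_interval)
    then have "cyclic_interval n i k \<noteq> {..<n}" by force
    then show ?thesis using that by (simp add: cyclic_interval_mem_connected_sets)
  qed
  then show "?I ` ?P \<subseteq> ?C" by (simp add: image_subset_iff split_paired_Ball_Sigma)
  show "?C \<subseteq> ?I ` ?P"
  proof
    fix S assume "S \<in> ?C"
    then obtain i k where "i < n" "k \<in> {1..<n}" "S = cyclic_interval n i k"
      using connected_set_cycle_graph_eq_cyclic_interval[of S n] by blast
    then show "S \<in> ?I ` ?P" by (intro image_eqI[of _ _ "(i, k)"]) simp_all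
  qed
qed

lemma poly_connected_set_poly_cycle_graph:
  assumes "n > 0"
  shows "poly (connected_set_poly (cycle_graph n)) w = w ^ n + of_nat n * (\<Sum>k = 1..<n. w ^ k)"
proof -
  let ?C = "connected_sets (cycle_graph n)"
  have "poly (connected_set_poly (cycle_graph n)) w =
      w ^ n + (\<Sum>S\<in>?C - {{..<n}}. w ^ card S)"
    using lessThan_mem_connected_sets_cycle_graph[OF assms]
    by (simp add: poly_connected_set_poly finite_connected_sets sum.remove[of _ "{..<n}"])
  also have "(\<Sum>S\<in>?C - {{..<n}}. w ^ card S) =
      (\<Sum>(i, k)\<in>{..<n} \<times> {1..<n}. w ^ card (cyclic_interval n i k))"
    by (simp add: case_prod_unfold
        flip: sum.reindex_bij_betw[OF bij_betw_cyclic_interval])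
  also have "\<dots> = (\<Sum>(i, k)\<in>{..<n} \<times> {1..<n}. w ^ k)"
    by (intro sum.cong) (auto simp: card_cyclic_interval)
  finally show ?thesis by (simp flip: sum.cartesian_product)
qed

lemma poly_connected_set_poly_cycle_graph_closed_form:
  assumes "n > 0"
  shows "(1 - w) * poly (connected_set_poly (cycle_graph n)) w =
    w * (of_nat n - (of_nat n - 1 + w) * w ^ (n - 1))"
proof -
  have "(\<Sum>k<n. w ^ k) = 1 + (\<Sum>k = 1..<n. w ^ k)"
    using assms by (simp add: lessThan_atLeast0 sum.atLeast_Suc_lessThan)
  then have geometric: "(1 - w) * (\<Sum>k = 1..<n. w ^ k) = w - w ^ n"
    using one_diff_power_eq[of w n] by (simp add: algebra_simps)
  have "(1 - w) * poly (connected_set_poly (cycle_graph n)) w =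
      (1 - w) * w ^ n + of_nat n * ((1 - w) * (\<Sum>k = 1..<n. w ^ k))"
    by (simp only: poly_connected_set_poly_cycle_graph[OF assms] distrib_left mult.left_commute)
  also have "\<dots> = of_nat n * w - (of_nat n - 1 + w) * w ^ n"
    unfolding geometric by (simp add: algebra_simps)
  also have "w ^ n = w * w ^ (n - 1)" using assms by (simp add: power_eq_if)
  finally show ?thesis by (simp add: algebra_simps)
qed

section \<open>Roots of cycles\<close>

lemma cycle_graph_root:
  fixes t :: real
  assumes "odd n" "t \<ge> 0" "(1 + t) ^ (n - 1) * (real n - 2 - t) = real n"
  shows "- complex_of_real t - 1 \<in> connected_graph_roots"
proof -
  interpret pair_graph "cycle_graph n" by (rule pair_graph_cycle_graph)
  define w where "w = - complex_of_real t - 1"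
  have n: "n > 0" using assms(1) by (rule odd_pos)
  have "w ^ (n - 1) = of_real (1 + t) ^ (n - 1)"
    using assms(1) power_minus_even[of "n - 1" w] by (simp add: w_def)
  moreover have "of_nat n - 1 + w = of_real (real n - 2 - t)" by (simp add: w_def)
  ultimately have "(of_nat n - 1 + w) * w ^ (n - 1) =
      of_real ((1 + t) ^ (n - 1) * (real n - 2 - t))"
    by simp
  then have "(1 - w) * poly (connected_set_poly (cycle_graph n)) w = 0"
    unfolding assms(3) by (simp add: poly_connected_set_poly_cycle_graph_closed_form[OF n])
  moreover have "Re (1 - w) \<noteq> 0" using assms(2) by (simp add: w_def)
  then have "1 - w \<noteq> 0" by fastforce
  ultimately show ?thesis
    using lessThan_mem_connected_sets_cycle_graph[OF n] pverts_mem_connected_sets_iff pair_graph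
    by (auto simp: connected_graph_roots_def simple_graph_def w_def intro!: exI[of _ "cycle_graph n"])
qed

lemma ex_large_cycle_graph_root:
  assumes "odd n" "n \<ge> 5"
  shows "\<exists>t\<in>{real n - 3..real n - 2}. - complex_of_real t - 1 \<in> connected_graph_roots"
proof -
  have "real n \<le> (real n - 2) ^ 2"
    using assms(2) mult_mono[of 3 "real n - 2" "real n - 2" "real n - 2"]
    by (simp add: power2_eq_square)
  also have "\<dots> \<le> (real n - 2) ^ (n - 1)"
    using assms(2) by (intro power_increasing) auto
  finally have "\<exists>t\<ge>real n - 3. t \<le> real n - 2 \<and> (1 + t) ^ (n - 1) * (real n - 2 - t) = real n"
    by (intro IVT2) (auto intro!: continuous_intros)
  then obtain t where "real n - 3 \<le> t" "t \<le> real n - 2"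
    "(1 + t) ^ (n - 1) * (real n - 2 - t) = real n"
    by blast
  then show ?thesis using assms by (intro bexI[of _ t] cycle_graph_root) auto
qed

lemma one_plus_power_mult_le_one:
  fixes a :: real
  assumes "0 \<le> a" "a \<le> 1"
  shows "(1 + a) ^ k * (1 - real k * a) \<le> 1"
proof -
  have "1 - real k * a \<le> (1 - a) ^ k"
    using Bernoulli_inequality[of "- a" k] assms by simp
  then have "(1 + a) ^ k * (1 - real k * a) \<le> (1 + a) ^ k * (1 - a) ^ k"
    using assms by (intro mult_left_mono) auto
  also have "\<dots> = (1 - a ^ 2) ^ k"
    by (simp add: algebra_simps power2_eq_square flip: power_mult_distrib)
  also have "\<dots> \<le> 1"
    using assms by (intro power_le_one) (auto simp: power_le_one)
  finally show ?thesis .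
qed

lemma ex_small_cycle_graph_root:
  assumes "odd n" "n \<ge> 5"
  shows "\<exists>t\<in>{1 / real n ^ 2..10 / real n ^ 2}. - complex_of_real t - 1 \<in> connected_graph_roots"
proof -
  define N where "N = real n"
  define a b where "a = 1 / N ^ 2" and "b = 10 / N ^ 2"
  have N: "N \<ge> 5" "real (n - 1) = N - 1" using assms(2) by (simp_all add: N_def)
  have "25 \<le> N ^ 2" using power_mono[of 5 N 2] N(1) by simp
  then have ab: "0 < a" "a \<le> b" "b \<le> 10 / 25"
    using N(1) by (auto simp: a_def b_def divide_simps)
  have lower: "(1 + a) ^ (n - 1) * (N - 2 - a) \<le> N"
  proof -
    have "N * ((1 + a) ^ (n - 1) * (1 - (N - 1) * a)) \<le> N"
      using one_plus_power_mult_le_one[of a "n - 1", unfolded N(2)] ab N(1) by simp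
    moreover have "N - 2 - a \<le> N * (1 - (N - 1) * a)"
      using N(1) by (simp add: a_def field_simps power2_eq_square)
    then have "(1 + a) ^ (n - 1) * (N - 2 - a) \<le> (1 + a) ^ (n - 1) * (N * (1 - (N - 1) * a))"
      using ab by (intro mult_left_mono) auto
    ultimately show ?thesis by (simp add: mult.left_commute)
  qed
  have upper: "N \<le> (1 + b) ^ (n - 1) * (N - 2 - b)"
  proof -
    have "4 / 5 * N \<le> N - 1" "2 / 5 * N \<le> N - 2 - b" using N(1) ab(3) by simp_all
    then have "4 / 5 * N * (2 / 5 * N) * b \<le> (N - 1) * (N - 2 - b) * b"
      using N(1) ab by (intro mult_right_mono mult_mono) auto
    moreover have "4 / 5 * N * (2 / 5 * N) * b = 16 / 5"
      using N(1) by (simp add: b_def power2_eq_square)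
    ultimately have "N \<le> (1 + (N - 1) * b) * (N - 2 - b)"
      using ab(3) by (simp add: algebra_simps)
    also have "\<dots> \<le> (1 + b) ^ (n - 1) * (N - 2 - b)"
      using Bernoulli_inequality[of b "n - 1", unfolded N(2)] ab N(1) by (intro mult_right_mono) auto
    finally show ?thesis .
  qed
  obtain t where "a \<le> t" "t \<le> b" "(1 + t) ^ (n - 1) * (N - 2 - t) = N"
    using IVT[OF lower upper ab(2)] by (auto intro!: continuous_intros)
  then show ?thesis
    using assms(1) ab(1) by (intro bexI[of _ t] cycle_graph_root) (auto simp: a_def b_def N_def)
qed

lemma ex_odd_nat_comparable:
  fixes x :: real
  assumes "x \<ge> 1"
  obtains n where "odd n" "n \<ge> 5" "x \<le> real n - 3" "real n \<le> 5 * x"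
proof
  define k where "k = nat \<lfloor>x\<rfloor>"
  have k: "real k \<le> x" "x < real k + 1" "k \<ge> 1"
    using assms unfolding k_def by linarith+
  then have "real k \<ge> 1" by simp
  with k show "odd (2 * k + 3)" "2 * k + 3 \<ge> 5" "x \<le> real (2 * k + 3) - 3"
    "real (2 * k + 3) \<le> 5 * x"
    by auto
qed

lemma ex_connected_graph_root_of_order:
  fixes x :: real
  assumes "x > 0"
  shows "\<exists>t\<in>{x / 25..10 * x}. - complex_of_real t - 1 \<in> connected_graph_roots"
proof (cases "x \<ge> 1")
  case True
  then obtain n where n: "odd n" "n \<ge> 5" "x \<le> real n - 3" "real n \<le> 5 * x"
    using ex_odd_nat_comparable by blast
  have "{real n - 3..real n - 2} \<subseteq> {x / 25..10 * x}" using n(3,4) assms by auto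
  then show ?thesis using ex_large_cycle_graph_root[OF n(1,2)] by blast
next
  case False
  define y where "y = 1 / sqrt x"
  have y: "y \<ge> 1" "x = 1 / y ^ 2" using assms False by (auto simp: y_def power_divide)
  obtain n where n: "odd n" "n \<ge> 5" "y \<le> real n - 3" "real n \<le> 5 * y"
    using ex_odd_nat_comparable[OF y(1)] by blast
  have "1 / (5 * y) ^ 2 \<le> 1 / real n ^ 2" "10 / real n ^ 2 \<le> 10 / y ^ 2"
    using n y(1) by (intro frac_le power_mono; simp)+
  then have "{1 / real n ^ 2..10 / real n ^ 2} \<subseteq> {x / 25..10 * x}"
    by (auto simp: y(2) power_mult_distrib)
  then show ?thesis using ex_small_cycle_graph_root[OF n(1,2)] by blast
qed

section \<open>Density of sets closed under taking roots\<close>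

lemma tendsto_root_if_comparable_powers:
  fixes t :: "nat \<Rightarrow> real"
  assumes "c > 0" "r > 0" and t: "\<And>m. c * r ^ m \<le> t m" "\<And>m. t m \<le> C * r ^ m"
  shows "(\<lambda>m. root m (t m)) \<longlonglongrightarrow> r"
proof (rule tendsto_sandwich)
  show "(\<lambda>m. root m c * r) \<longlonglongrightarrow> r"
    using tendsto_mult[OF LIMSEQ_root_const[OF assms(1)] tendsto_const[of r]] by simp
  have "C > 0" using t[of 0] assms(1) by simp
  then show "(\<lambda>m. root m C * r) \<longlonglongrightarrow> r"
    using tendsto_mult[OF LIMSEQ_root_const tendsto_const[of r]] by fastforce
  have root: "root m (a * r ^ m) = root m a * r" if "m > 0" for m a
    using that assms(2) by (simp add: real_root_mult real_root_power_cancel)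
  show "\<forall>\<^sub>F m in sequentially. root m c * r \<le> root m (t m)"
    using eventually_gt_at_top[of 0] by eventually_elim (metis root real_root_le_mono t(1))
  show "\<forall>\<^sub>F m in sequentially. root m (t m) \<le> root m C * r"
    using eventually_gt_at_top[of 0] by eventually_elim (metis root real_root_le_mono t(2))
qed

lemma ex_angle_multiple_close:
  assumes "m > 0"
  shows "\<exists>\<phi>. cis (real m * \<phi>) = cis \<alpha> \<and> \<bar>\<phi> - \<theta>\<bar> \<le> 2 * pi / real m"
proof -
  define y where "y = (real m * \<theta> - \<alpha>) / (2 * pi)"
  define \<phi> where "\<phi> = (\<alpha> + 2 * pi * of_int \<lfloor>y\<rfloor>) / real m"
  have "cis (real m * \<phi>) = cis \<alpha>"
    using assms by (simp add: \<phi>_def flip: cis_mult)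
  moreover have "\<bar>\<phi> - \<theta>\<bar> \<le> 2 * pi / real m"
  proof -
    have "real m * (\<phi> - \<theta>) = 2 * pi * (of_int \<lfloor>y\<rfloor> - y)"
      using assms by (simp add: \<phi>_def y_def field_simps)
    moreover have "\<bar>of_int \<lfloor>y\<rfloor> - y\<bar> \<le> 1" by linarith
    then have "2 * pi * \<bar>of_int \<lfloor>y\<rfloor> - y\<bar> \<le> 2 * pi" by (simp add: mult_left_le)
    ultimately have "real m * \<bar>\<phi> - \<theta>\<bar> \<le> 2 * pi"
      by (metis abs_mult abs_numeral abs_of_nat abs_of_pos pi_gt_zero)
    then show ?thesis using assms by (simp add: pos_le_divide_eq mult.commute)
  qed
  ultimately show ?thesis by blast
qed

lemma ex_roots_tendsto:
  fixes a :: "nat \<Rightarrow> complex"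
  assumes "(\<lambda>m. root m (norm (a m))) \<longlonglongrightarrow> norm u"
  obtains w where "\<And>m. m > 0 \<Longrightarrow> w m ^ m = a m" "w \<longlonglongrightarrow> u"
proof -
  have "\<exists>\<phi>. m > 0 \<longrightarrow> cis (real m * \<phi>) = cis (Arg (a m)) \<and> \<bar>\<phi> - Arg u\<bar> \<le> 2 * pi / real m" for m
    using ex_angle_multiple_close[of m] by blast
  then obtain \<phi> where \<phi>: "\<And>m. m > 0 \<Longrightarrow> cis (real m * \<phi> m) = cis (Arg (a m))"
      "\<And>m. m > 0 \<Longrightarrow> \<bar>\<phi> m - Arg u\<bar> \<le> 2 * pi / real m"
    by metis
  define w where "w m = rcis (root m (norm (a m))) (\<phi> m)" for m
  have "w m ^ m = a m" if "m > 0" for m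
  proof -
    have "w m ^ m = rcis (norm (a m)) (real m * \<phi> m)"
      using that by (simp add: w_def DeMoivre2)
    also have "\<dots> = rcis (norm (a m)) (Arg (a m))" using \<phi>(1)[OF that] by (simp add: rcis_def)
    also have "\<dots> = a m" by (rule rcis_cmod_Arg)
    finally show ?thesis .
  qed
  moreover have "(\<lambda>m. \<phi> m - Arg u) \<longlonglongrightarrow> 0"
  proof (rule Lim_null_comparison)
    show "\<forall>\<^sub>F m in sequentially. norm (\<phi> m - Arg u) \<le> 2 * pi / real m"
      using eventually_gt_at_top[of 0] by eventually_elim (simp add: \<phi>(2))
  qed (rule lim_const_over_n)
  then have "\<phi> \<longlonglongrightarrow> Arg u" by (rule LIM_zero_cancel)
  then have "w \<longlonglongrightarrow> rcis (norm u) (Arg u)"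
    unfolding w_def rcis_def cis_conv_exp by (intro tendsto_intros assms)
  then have "w \<longlonglongrightarrow> u" by (simp only: rcis_cmod_Arg)
  ultimately show thesis by (rule that)
qed

lemma closure_eq_UNIV_if_closed_under_roots:
  fixes U :: "complex set"
  assumes root: "\<And>u m. m > 0 \<Longrightarrow> u ^ m \<in> U \<Longrightarrow> u \<in> U"
    and "c > 0" and order: "\<And>x :: real. x > 0 \<Longrightarrow> \<exists>a\<in>U. c * x \<le> norm a \<and> norm a \<le> C * x"
  shows "closure U = UNIV"
proof -
  have "u \<in> closure U" if "u \<noteq> 0" for u
  proof -
    have "\<exists>a\<in>U. c * norm u ^ m \<le> norm a \<and> norm a \<le> C * norm u ^ m" for m
      using that by (intro order) simp
    then obtain a where a: "\<And>m. a m \<in> U"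
        "\<And>m. c * norm u ^ m \<le> norm (a m)" "\<And>m. norm (a m) \<le> C * norm u ^ m"
      by metis
    have "(\<lambda>m. root m (norm (a m))) \<longlonglongrightarrow> norm u"
      using that by (intro tendsto_root_if_comparable_powers[OF \<open>c > 0\<close> _ a(2,3)]) simp
    then obtain w where w: "\<And>m. m > 0 \<Longrightarrow> w m ^ m = a m" "w \<longlonglongrightarrow> u"
      using ex_roots_tendsto by blast
    have "w (Suc m) \<in> U" for m by (rule root[of "Suc m"]) (simp_all only: w(1) a(1) zero_less_Suc)
    moreover have "(\<lambda>m. w (Suc m)) \<longlonglongrightarrow> u" using w(2) by (rule LIMSEQ_Suc)
    ultimately show ?thesis unfolding closure_sequential by (intro exI[of _ "\<lambda>m. w (Suc m)"]) simp
  qed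
  then have "closure (- {0}) \<subseteq> closure U" by (intro closure_minimal) auto
  then show ?thesis by (auto simp: closure_complement)
qed

lemma closure_connected_graph_roots: "closure connected_graph_roots = UNIV"
proof -
  have "closure ((+) 1 ` connected_graph_roots) = UNIV"
  proof (rule closure_eq_UNIV_if_closed_under_roots)
    fix u :: complex and m :: nat
    assume "m > 0" and "u ^ m \<in> (+) 1 ` connected_graph_roots"
    then have "(1 + (u - 1)) ^ m - 1 \<in> connected_graph_roots" by fastforce
    with \<open>m > 0\<close> have "u - 1 \<in> connected_graph_roots" by (rule mem_connected_graph_roots_if_power)
    then show "u \<in> (+) 1 ` connected_graph_roots" by (rule rev_image_eqI) simp
  next
    fix x :: real assume "x > 0"
    then obtain t where t: "x / 25 \<le> t" "t \<le> 10 * x"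
      and root: "- complex_of_real t - 1 \<in> connected_graph_roots"
      using ex_connected_graph_root_of_order by fastforce
    from root have "- complex_of_real t \<in> (+) 1 ` connected_graph_roots"
      by (rule rev_image_eqI) simp
    then show "\<exists>a\<in>(+) 1 ` connected_graph_roots. 1 / 25 * x \<le> norm a \<and> norm a \<le> 10 * x"
      by (rule rev_bexI) (use \<open>x > 0\<close> t in simp)
  qed simp
  then have "(+) 1 ` closure connected_graph_roots = (+) 1 ` (UNIV :: complex set)"
    by (simp add: closure_translation)
  then show ?thesis by (simp only: inj_image_eq_iff[OF inj_on_add])
qed

theorem theorem12:
  shows "closure {z :: complex. \<exists>G :: nat pair_pre_digraph.
           simple_graph G \<and> poly (connected_set_poly G) z = 0} = UNIV \<and>
         closure {z :: complex. \<exists>G :: nat pair_pre_digraph.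
           simple_graph G \<and> Digraph_Component.connected (with_proj G) \<and>
           poly (connected_set_poly G) z = 0} = UNIV"
    (is "closure ?A = UNIV \<and> closure ?B = UNIV")
proof -
  have "closure ?B = UNIV"
    using closure_connected_graph_roots by (simp add: connected_graph_roots_def)
  moreover have "closure ?B \<subseteq> closure ?A" by (rule closure_mono) blast
  ultimately show ?thesis by blast
qed

end
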